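(* Let $D,d,\eta,\alpha,\bar R>0$ be fixed, and for $\rho>0$ let the secrecy rate $R_s$ and the secrecy outage probability $\mathbb{P}=\mathbb{P}(\rho)=\Pr(R_s<\bar R)$ be as in the context. Then the diversity order of Bob, $$\mathcal{D}=-\lim_{\rho\to\infty}\frac{\log\mathbb{P}(\rho)}{\log\rho},$$ exists and equals $0$.
   Context: System model. Let $x_1,y_1,x_2,y_2$ be independent random variables, each uniform on $[-\frac D2,\frac D2]$. The legitimate user (Bob) is at $\psi_b=[x_1,y_1,0]$, the eavesdropper (Willie) is at $\psi_w=[x_2,y_2,0]$, and the pinching antenna is at $\psi_1^{Pin}=[x_1,0,d]$ on a waveguide at height $d$ parallel to the $x$-axis. The waveguide feed point $\psi_0$ is a fixed point $[x_0,0,d]$ with $x_0\in[-\frac D2,\frac D2]$, so that $0\le|\psi_0-\psi_1^{Pin}|\le D$. Put $Z_b=|\psi_1^{Pin}-\psi_b|^2=y_1^2+d^2$ and $Z_w=|\psi_1^{Pin}-\psi_w|^2=(x_1-x_2)^2+y_2^2+d^2$ (Euclidean norm). Here $\eta>0$ is a constant, $\alpha$ is the waveguide attenuation constant, and $\rho>0$ is the transmit signal-to-noise ratio (transmit power divided by the noise variance, which is the same for Bob and Willie). The rates are $$R_b=\tfrac12\log_2\!\left(1+\frac{\eta\rho e^{-2\alpha|\psi_0-\psi_1^{Pin}|}}{Z_b}\right),\quad R_w=\tfrac12\log_2\!\left(1+\frac{\eta\rho e^{-2\alpha|\psi_0-\psi_1^{Pin}|}}{Z_w}\right),\quad R_s=R_b-R_w.$$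 $\bar R$ is the target secrecy rate. *)

theory Defs
  imports "HOL-Probability.Probability"
begin

definition user_pos :: "real \<Rightarrow> real \<Rightarrow> real ^ 3" where
  "user_pos x y = vector [x, y, 0]"

definition waveguide_pos :: "real \<Rightarrow> real \<Rightarrow> real ^ 3" where
  "waveguide_pos d x = vector [x, 0, d]"

definition rate :: "real \<Rightarrow> real \<Rightarrow> real ^ 3 \<Rightarrow> real ^ 3 \<Rightarrow> real \<Rightarrow> real ^ 3 \<Rightarrow> real" where
  "rate \<eta> \<alpha> feed pin \<rho> user =
     1 / 2 * log 2 (1 + \<eta> * \<rho> * exp (- 2 * \<alpha> * norm (feed - pin)) / (norm (pin - user))\<^sup>2)"

text \<open>Bob is at \<open>(x1, y1, 0)\<close>, Willie at \<open>(x2, y2, 0)\<close>; the pinching antenna is placed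
  at Bob's x-coordinate, and \<open>x0\<close> is the x-coordinate of the feed point.\<close>

definition secrecy_rate ::
  "real \<Rightarrow> real \<Rightarrow> real \<Rightarrow> real \<Rightarrow> real \<Rightarrow> real \<Rightarrow> real \<Rightarrow> real \<Rightarrow> real \<Rightarrow> real" where
  "secrecy_rate d \<eta> \<alpha> x0 \<rho> x1 y1 x2 y2 =
     rate \<eta> \<alpha> (waveguide_pos d x0) (waveguide_pos d x1) \<rho> (user_pos x1 y1)
     - rate \<eta> \<alpha> (waveguide_pos d x0) (waveguide_pos d x1) \<rho> (user_pos x2 y2)"

text \<open>\<open>-lim log P(\<rho>) / log \<rho>\<close> exists in the reals and equals \<open>\<delta>\<close>. Positivity of \<open>P\<close> is required
  because \<open>ln 0 = 0\<close> here, so that a vanishing \<open>P\<close> would otherwise have diversity order 0.\<close>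

definition has_diversity_order :: "(real \<Rightarrow> real) \<Rightarrow> real \<Rightarrow> bool" where
  "has_diversity_order P \<delta> \<longleftrightarrow>
     (\<forall>\<^sub>F \<rho> in at_top. 0 < P \<rho>) \<and>
     (\<exists>L. ((\<lambda>\<rho>. ln (P \<rho>) / ln \<rho>) \<longlongrightarrow> L) at_top \<and> \<delta> = - L)"


lemma bob_distance_squared:
  "(norm (waveguide_pos d x1 - user_pos x1 y1))\<^sup>2 = y1\<^sup>2 + d\<^sup>2"
  by (simp add: waveguide_pos_def user_pos_def norm_vec_def L2_set_def sum_3)

lemma willie_distance_squared:
  "(norm (waveguide_pos d x1 - user_pos x2 y2))\<^sup>2 = (x1 - x2)\<^sup>2 + y2\<^sup>2 + d\<^sup>2"
  by (simp add: waveguide_pos_def user_pos_def norm_vec_def L2_set_def sum_3)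

lemma feed_distance:
  "norm (waveguide_pos d x0 - waveguide_pos d x1) = \<bar>x0 - x1\<bar>"
  by (simp add: waveguide_pos_def norm_vec_def L2_set_def sum_3)

end

theory Submission
  imports Defs
begin

text \<open>If Willie is at least as close to the antenna as Bob, then the secrecy rate is nonpositive
  at every signal-to-noise ratio. Since that happens with a positive probability, which does not
  depend on \<open>\<rho>\<close>, the outage probability is bounded away from 0.\<close>

text \<open>This vector-free form serves both the comparison of the two rates and the measurability
  of the outage event.\<close>

lemma secrecy_rate_eq:
  "secrecy_rate d \<eta> \<alpha> x0 \<rho> x1 y1 x2 y2 =
     1 / 2 * log 2 (1 + \<eta> * \<rho> * exp (- 2 * \<alpha> * \<bar>x0 - x1\<bar>) / (y1\<^sup>2 + d\<^sup>2))
     - 1 / 2 * log 2 (1 + \<eta> * \<rho> * exp (- 2 * \<alpha> * \<bar>x0 - x1\<bar>) / ((x1 - x2)\<^sup>2 + y2\<^sup>2 + d\<^sup>2))"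
  by (simp add: secrecy_rate_def rate_def bob_distance_squared willie_distance_squared feed_distance)

text \<open>Bob and Willie share the same numerator, feed attenuation included, so only the squared
  distances matter; \<open>d\<^sup>2\<close> cancels in comparing them. A nonzero \<open>d\<close>
  keeps Willie's distance positive even directly below the antenna, where division by 0 would give 0
  and spoil the comparison.\<close>

lemma secrecy_rate_nonpos:
  assumes "d \<noteq> 0" "\<eta> \<ge> 0" "\<rho> \<ge> 0" and "(x1 - x2)\<^sup>2 + y2\<^sup>2 \<le> y1\<^sup>2"
  shows "secrecy_rate d \<eta> \<alpha> x0 \<rho> x1 y1 x2 y2 \<le> 0"
proof -
  let ?c = "\<eta> * \<rho> * exp (- 2 * \<alpha> * \<bar>x0 - x1\<bar>)"
  have "0 \<le> ?c" using assms by simp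
  moreover have "0 < (x1 - x2)\<^sup>2 + y2\<^sup>2 + d\<^sup>2"
    using assms(1) by (simp add: add_nonneg_pos)
  moreover have "(x1 - x2)\<^sup>2 + y2\<^sup>2 + d\<^sup>2 \<le> y1\<^sup>2 + d\<^sup>2" using assms(4) by simp
  ultimately have "?c / (y1\<^sup>2 + d\<^sup>2) \<le> ?c / ((x1 - x2)\<^sup>2 + y2\<^sup>2 + d\<^sup>2)"
    by (intro divide_left_mono mult_pos_pos) auto
  moreover have "0 \<le> ?c / (y1\<^sup>2 + d\<^sup>2)"
    using \<open>0 \<le> ?c\<close> by (intro divide_nonneg_nonneg) auto
  ultimately have "log 2 (1 + ?c / (y1\<^sup>2 + d\<^sup>2)) \<le> log 2 (1 + ?c / ((x1 - x2)\<^sup>2 + y2\<^sup>2 + d\<^sup>2))"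
    by simp
  then show ?thesis unfolding secrecy_rate_eq by simp
qed

text \<open>The numerator \<open>ln (P \<rho>)\<close> stays between \<open>ln c\<close> and
  \<open>ln C\<close> while \<open>ln \<rho>\<close> tends to infinity. The bound \<open>c\<close>
  also supplies the positivity that the definition demands.\<close>

lemma has_diversity_order_0:
  assumes "0 < c" and lower: "\<forall>\<^sub>F \<rho> in at_top. c \<le> P \<rho>" and upper: "\<forall>\<^sub>F \<rho> in at_top. P \<rho> \<le> C"
  shows "has_diversity_order P 0"
proof -
  have "((\<lambda>\<rho>. ln (P \<rho>) / ln \<rho>) \<longlongrightarrow> 0) at_top"
  proof (rule tendsto_sandwich)
    have "\<forall>\<^sub>F \<rho> in at_top. ln c / ln \<rho> \<le> ln (P \<rho>) / ln \<rho> \<and> ln (P \<rho>) / ln \<rho> \<le> ln C / ln \<rho>"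
      \<comment> \<open>For \<rho> > 1 the denominator \<open>ln \<rho>\<close> is positive, so
        division preserves both bounds.\<close>
      using lower upper eventually_gt_at_top[of 1]
      by eventually_elim (use \<open>0 < c\<close> in \<open>auto intro!: divide_right_mono ln_mono\<close>)
    then show "\<forall>\<^sub>F \<rho> in at_top. ln c / ln \<rho> \<le> ln (P \<rho>) / ln \<rho>"
      and "\<forall>\<^sub>F \<rho> in at_top. ln (P \<rho>) / ln \<rho> \<le> ln C / ln \<rho>"
      by (auto elim: eventually_mono)
  qed (intro real_tendsto_divide_at_top[OF tendsto_const] ln_at_top)+
  moreover have "\<forall>\<^sub>F \<rho> in at_top. 0 < P \<rho>"
    using lower by eventually_elim (use \<open>0 < c\<close> in linarith)
  ultimately show ?thesis unfolding has_diversity_order_def by force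
qed

text \<open>The distribution function is affine on \<open>{a..b}\<close>, hence strictly larger at
  \<open>v\<close> than at \<open>u\<close>. The union bound suffices: \<open>{u..v}\<close> must
  carry at least this increase, and the shared endpoint \<open>u\<close> does no harm.\<close>

lemma (in prob_space) uniform_distributed_prob_pos:
  fixes X :: "'a \<Rightarrow> real"
  assumes X: "distributed M lborel X (\<lambda>t. indicator {a..b} t / measure lborel {a..b})"
    and "u < v" "{u..v} \<subseteq> {a..b}"
  shows "0 < prob (X -` {u..v} \<inter> space M)"
proof -
  from assms(2,3) have "a \<le> u" "v \<le> b" by auto
  have "a < b" by (rule uniform_distributed_bounds[OF X])
  have [measurable]: "X \<in> borel_measurable M" using distributed_measurable[OF X] by simp
  have "(v - a) / (b - a) = \<P>(x in M. X x \<le> v)"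
    using uniform_distributed_measure[OF X, of v] \<open>a \<le> u\<close> \<open>u < v\<close> \<open>v \<le> b\<close> by simp
  also have "\<dots> \<le> prob ({x \<in> space M. X x \<le> u} \<union> X -` {u..v} \<inter> space M)"
    by (rule finite_measure_mono) auto
  also have "\<dots> \<le> \<P>(x in M. X x \<le> u) + prob (X -` {u..v} \<inter> space M)"
    by (rule measure_Un_le) auto
  also have "\<P>(x in M. X x \<le> u) = (u - a) / (b - a)"
    using uniform_distributed_measure[OF X, of u] \<open>a \<le> u\<close> \<open>u < v\<close> \<open>v \<le> b\<close> by simp
  finally have "(v - a) / (b - a) \<le> (u - a) / (b - a) + prob (X -` {u..v} \<inter> space M)" .
  moreover have "(u - a) / (b - a) < (v - a) / (b - a)"
    using \<open>a < b\<close> \<open>u < v\<close> by (simp add: divide_strict_right_mono)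
  ultimately show ?thesis by linarith
qed

theorem corollary1:
  fixes M :: "'a measure"
    and x1 y1 x2 y2 :: "'a \<Rightarrow> real"
    and D d \<eta> \<alpha> Rbar x0 :: real
  assumes "prob_space M"
    and "D > 0" and "d > 0" and "\<eta> > 0" and "\<alpha> > 0" and "Rbar > 0"
    and "x0 \<in> {- D / 2..D / 2}"
    and "prob_space.indep_vars M (\<lambda>_. borel) (\<lambda>i. [x1, y1, x2, y2] ! i) {0..<4}"
    and "\<forall>X \<in> {x1, y1, x2, y2}. distributed M lborel X
           (\<lambda>t. indicator {- D / 2..D / 2} t / measure lborel {- D / 2..D / 2})"
  shows "has_diversity_order
           (\<lambda>\<rho>. measure M {\<omega> \<in> space M.
              secrecy_rate d \<eta> \<alpha> x0 \<rho> (x1 \<omega>) (y1 \<omega>) (x2 \<omega>) (y2 \<omega>) < Rbar}) 0"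
proof -
  interpret prob_space M by fact
  have [measurable]: "x1 \<in> borel_measurable M" "y1 \<in> borel_measurable M"
      "x2 \<in> borel_measurable M" "y2 \<in> borel_measurable M"
    using assms(9) by (auto dest!: distributed_measurable)
  \<comment> \<open>Index 1 is \<open>y1\<close>: Bob is kept far from the waveguide and Willie near
    the antenna. The cutoffs give Willie's side at most 2 (D/8)^2 = D^2/32, below (D/4)^2 = D^2/16
    on Bob's side.\<close>
  define I where "I i = (if i = 1 then {D / 4..D / 2} else {0..D / 8})" for i :: nat
  define G where "G = (\<Inter>i\<in>{0..<4}. ([x1, y1, x2, y2] ! i) -` I i \<inter> space M)"
  have "0 < prob (([x1, y1, x2, y2] ! i) -` I i \<inter> space M)" if "i \<in> {0..<4}" for i
  proof -
    have "[x1, y1, x2, y2] ! i \<in> set [x1, y1, x2, y2]"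
      using that by (intro nth_mem) simp
    then have "distributed M lborel ([x1, y1, x2, y2] ! i)
        (\<lambda>t. indicator {- D / 2..D / 2} t / measure lborel {- D / 2..D / 2})"
      using assms(9) unfolding list.set by blast
    from uniform_distributed_prob_pos[OF this, of "D / 4" "D / 2"]
      uniform_distributed_prob_pos[OF this, of 0 "D / 8"]
    show ?thesis
      using \<open>D > 0\<close> by (cases "i = 1") (simp_all add: I_def)
  qed
  then have "0 < (\<Prod>i\<in>{0..<4}. prob (([x1, y1, x2, y2] ! i) -` I i \<inter> space M))"
    by (rule prod_pos)
  \<comment> \<open>Independence turns the product of the four positive marginals into the
    probability of the joint event.\<close>
  also have "\<dots> = prob G"
    unfolding G_def by (rule indep_varsD[OF assms(8), symmetric]) (auto simp: I_def)
  finally have "0 < prob G" .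
  have outage: "G \<subseteq> {\<omega> \<in> space M.
      secrecy_rate d \<eta> \<alpha> x0 \<rho> (x1 \<omega>) (y1 \<omega>) (x2 \<omega>) (y2 \<omega>) < Rbar}" if "\<rho> > 0" for \<rho>
  proof
    fix \<omega> assume "\<omega> \<in> G"
    then have *: "\<omega> \<in> space M \<and> ([x1, y1, x2, y2] ! i) \<omega> \<in> I i" if "i \<in> {0..<4}" for i
      using that unfolding G_def by blast
    have \<omega>: "\<omega> \<in> space M" "0 \<le> x1 \<omega>" "x1 \<omega> \<le> D / 8" "D / 4 \<le> y1 \<omega>"
        "0 \<le> x2 \<omega>" "x2 \<omega> \<le> D / 8" "0 \<le> y2 \<omega>" "y2 \<omega> \<le> D / 8"
      using *[of 0] *[of 1] *[of 2] *[of 3] by (simp_all add: I_def numeral_3_eq_3)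
    \<comment> \<open>Two points of \<open>{0..D / 8}\<close> differ by at most D/8 in absolute
      value.\<close>
    have "(x1 \<omega> - x2 \<omega>)\<^sup>2 \<le> (D / 8)\<^sup>2"
      using \<omega> unfolding abs_le_square_iff[symmetric] by linarith
    moreover have "(y2 \<omega>)\<^sup>2 \<le> (D / 8)\<^sup>2" "(D / 4)\<^sup>2 \<le> (y1 \<omega>)\<^sup>2"
      using \<omega> \<open>D > 0\<close> by (auto intro!: power_mono)
    moreover have "(D / 8)\<^sup>2 + (D / 8)\<^sup>2 \<le> (D / 4)\<^sup>2"
      by (simp add: power2_eq_square)
    ultimately have "secrecy_rate d \<eta> \<alpha> x0 \<rho> (x1 \<omega>) (y1 \<omega>) (x2 \<omega>) (y2 \<omega>) \<le> 0"
      using assms \<open>\<rho> > 0\<close> by (intro secrecy_rate_nonpos) auto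
    with \<omega> \<open>Rbar > 0\<close> show "\<omega> \<in> {\<omega> \<in> space M.
      secrecy_rate d \<eta> \<alpha> x0 \<rho> (x1 \<omega>) (y1 \<omega>) (x2 \<omega>) (y2 \<omega>) < Rbar}" by simp
  qed
  show ?thesis
  proof (rule has_diversity_order_0[where C = 1, OF \<open>0 < prob G\<close>])
    \<comment> \<open>Monotonicity of \<open>prob\<close> needs the larger set to be an event: a
      nonmeasurable set would have measure 0 by default.\<close>
    have "{\<omega> \<in> space M. secrecy_rate d \<eta> \<alpha> x0 \<rho> (x1 \<omega>) (y1 \<omega>) (x2 \<omega>) (y2 \<omega>) < Rbar} \<in> events" for \<rho>
      unfolding secrecy_rate_eq by measurable
    then show "\<forall>\<^sub>F \<rho> in at_top. prob G \<le> prob {\<omega> \<in> space M.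
        secrecy_rate d \<eta> \<alpha> x0 \<rho> (x1 \<omega>) (y1 \<omega>) (x2 \<omega>) (y2 \<omega>) < Rbar}"
      using outage
      by (auto simp only: intro!: eventually_mono[OF eventually_gt_at_top[of 0]] finite_measure_mono)
  qed simp
qed

end
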